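(* Let $(\Omega,\mathcal{F},\mu)$ be a measure space and $X$ a Banach space with a Gâteaux differentiable norm. Let $1<p<\infty$, let $k\ge1$ be an integer, and let $f\in L^p(X)$. If $h$ is a minimizer for $f$ in $\mathscr{G}_{p,k}(X)$, then the reduced form of $h$ is in simple special $f$-Voronoi form.
   Context: A simple function is a function $\sum_{i=1}^n x_i\mathbf{1}_{A_i}$ with $n\ge 1$, $x_i\in X$, $A_i\in\mathcal{F}$. A function $f:\Omega\to X$ is strongly measurable if it is a pointwise limit of a sequence of simple functions. For $1\le p<\infty$, $L^p(X)=L^p(\Omega,\mathcal{F},\mu,X)$ is the Bochner space of strongly measurable $f:\Omega\to X$ with $\int_\Omega\|f\|^p\,d\mu<\infty$ (functions equal a.e. are identified), with norm $\|f\|_p=\left(\int_\Omega\|f\|^p\,d\mu\right)^{1/p}$. The norm of $X$ is Gâteaux differentiable if it is so at every nonzero point of $X$. $\mathscr{G}_{p,k}(X)$ is the set of all functions $\sum_{i=1}^{l}x_i\mathbf{1}_{A_i}\in L^p(X)$ with $l\le k$, $\{A_i\}_{1\le i\le l}\subset\mathcal{F}$ a partition of $\Omega$, and $x_1,\dots,x_l\in X$. A minimizer for $f$ in $\mathscr{G}_{p,k}(X)$ is an $h\in\mathscr{G}_{p,k}(X)$ with $\|f-h\|_p=\inf_{g\in\mathscr{G}_{p,k}(X)}\|f-g\|_p$. A simple function written $h=\sum_{i=1}^m x_i\mathbf{1}_{A_i}$ is in reduced form if the $x_i$ are all different and $\{A_i\}_{1\le i\le m}$ is a measurable partition of $\Omega$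 into sets of positive measure, up to null sets (that is, $\mu(A_i\cap A_j)=0$ for $i\ne j$ and $\mu(\Omega\setminus\bigcup_iA_i)=0$). For a finite set $\mathbf{x}=\{x_1,\dots,x_m\}\subset X$ of different points, its Voronoi cells are $V_i=\{y\in X:\|y-x_i\|\le\min_{j\ne i}\|y-x_j\|\}$, $1\le i\le m$ (with $V_1=X$ if $m=1$). Write $\mathrm{int}(V_i)=\{y\in X:\|y-x_i\|<\|y-x_j\|\text{ for all }j\ne i\}$ and $\partial V_i=V_i\setminus\mathrm{int}(V_i)=\{y\in V_i:\|y-x_i\|=\|y-x_j\|\text{ for some }j\ne i\}$. If $h=\sum_{i=1}^m x_i\mathbf{1}_{A_i}$ is in reduced form, it is in $f$-Voronoi form if $A_i\subset f^{-1}(V_i)$ up to a $\mu$-null set for all $i$. For $A\in\mathcal{F}$ and $x\in X$ put $M_p(f,A)(x)=\int_A\|f(w)-x\|^p\,\mu(dw)\in[0,\infty]$. A point $x\in X$ is a $p$-th mean of $f$ in $A$ if $M_p(f,A)(x)=\inf_{y\in X}M_p(f,A)(y)$. A function $h=\sum_{i=1}^m x_i\mathbf{1}_{A_i}$ in $f$-Voronoi form is in special $f$-Voronoi form if, for every $i$, $x_i$ is a $p$-th mean of $f$ in $A_i$. It is in simple special $f$-Voronoi form if moreover, for every $i$, $\mu(f^{-1}(\partial V_i))=0$, that is, $A_i=f^{-1}(\mathrm{int}(V_i))$ up to a $\mu$-null set. *)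

theory Defs
  imports "HOL-Analysis.Analysis"
begin

text \<open>
  The Banach space is an arbitrary type of class \<open>banach\<close>, not assumed separable, so strong
  measurability is genuinely stronger than Borel measurability and is stated explicitly.
\<close>

definition strongly_measurable :: "'w measure \<Rightarrow> ('w \<Rightarrow> 'a::banach) \<Rightarrow> bool" where
  "strongly_measurable M f \<longleftrightarrow>
     (\<exists>s. (\<forall>n::nat. simple_function M (s n)) \<and> (\<forall>w\<in>space M. (\<lambda>n. s n w) \<longlonglongrightarrow> f w))"

text \<open>
  Elements of \<open>L\<^sup>p\<close> are represented by functions; the identification of functions that are equal
  almost everywhere is built into the predicates below.
\<close>

definition Lp_space :: "'w measure \<Rightarrow> real \<Rightarrow> ('w \<Rightarrow> 'a::banach) set" where
  "Lp_space M p = {f. strongly_measurable M f \<and> integrable M (\<lambda>w. norm (f w) powr p)}"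

definition Lp_norm :: "'w measure \<Rightarrow> real \<Rightarrow> ('w \<Rightarrow> 'a::banach) \<Rightarrow> real" where
  "Lp_norm M p f = (\<integral>w. norm (f w) powr p \<partial>M) powr (1 / p)"

definition gateaux_differentiable_at ::
    "('a::real_normed_vector \<Rightarrow> 'b::real_normed_vector) \<Rightarrow> 'a \<Rightarrow> bool" where
  "gateaux_differentiable_at F x \<longleftrightarrow>
     (\<exists>D. bounded_linear D \<and>
        (\<forall>v. ((\<lambda>t. F (x + t *\<^sub>R v)) has_vector_derivative D v) (at 0)))"

definition step_sum :: "nat \<Rightarrow> (nat \<Rightarrow> 'a::real_vector) \<Rightarrow> (nat \<Rightarrow> 'w set) \<Rightarrow> 'w \<Rightarrow> 'a" where
  "step_sum m x A w = (\<Sum>i<m. indicator (A i) w *\<^sub>R x i)"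

text \<open>Pieces of the partition may be empty; this does not change the set of functions.\<close>

definition Gpk :: "'w measure \<Rightarrow> real \<Rightarrow> nat \<Rightarrow> ('w \<Rightarrow> 'a::banach) set" where
  "Gpk M p k = {g \<in> Lp_space M p. \<exists>l x A. l \<le> k \<and>
     (\<forall>i<l. A i \<in> sets M) \<and> disjoint_family_on A {..<l} \<and> (\<Union>i<l. A i) = space M \<and>
     (AE w in M. g w = step_sum l x A w)}"

definition is_minimizer ::
    "'w measure \<Rightarrow> real \<Rightarrow> nat \<Rightarrow> ('w \<Rightarrow> 'a::banach) \<Rightarrow> ('w \<Rightarrow> 'a) \<Rightarrow> bool" where
  "is_minimizer M p k f h \<longleftrightarrow>
     h \<in> Gpk M p k \<and>
     Lp_norm M p (\<lambda>w. f w - h w) = (INF g\<in>Gpk M p k. Lp_norm M p (\<lambda>w. f w - g w))"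

text \<open>
  The case \<open>m = 0\<close> is allowed; it occurs only if the whole space has measure zero.
\<close>

definition reduced_form ::
    "'w measure \<Rightarrow> ('w \<Rightarrow> 'a::banach) \<Rightarrow> nat \<Rightarrow> (nat \<Rightarrow> 'a) \<Rightarrow> (nat \<Rightarrow> 'w set) \<Rightarrow> bool" where
  "reduced_form M h m x A \<longleftrightarrow>
     inj_on x {..<m} \<and>
     (\<forall>i<m. A i \<in> sets M \<and> emeasure M (A i) > 0) \<and>
     (\<forall>i<m. \<forall>j<m. i \<noteq> j \<longrightarrow> A i \<inter> A j \<in> null_sets M) \<and>
     space M - (\<Union>i<m. A i) \<in> null_sets M \<and>
     (AE w in M. h w = step_sum m x A w)"

definition voronoi_cell :: "nat \<Rightarrow> (nat \<Rightarrow> 'a::real_normed_vector) \<Rightarrow> nat \<Rightarrow> 'a set" where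
  "voronoi_cell m x i = {y. \<forall>j<m. j \<noteq> i \<longrightarrow> norm (y - x i) \<le> norm (y - x j)}"

text \<open>These are defined by (in)equalities of distances; \<open>voronoi_int\<close> is not the topological
  interior in general.\<close>

definition voronoi_int :: "nat \<Rightarrow> (nat \<Rightarrow> 'a::real_normed_vector) \<Rightarrow> nat \<Rightarrow> 'a set" where
  "voronoi_int m x i = {y. \<forall>j<m. j \<noteq> i \<longrightarrow> norm (y - x i) < norm (y - x j)}"

definition voronoi_boundary :: "nat \<Rightarrow> (nat \<Rightarrow> 'a::real_normed_vector) \<Rightarrow> nat \<Rightarrow> 'a set" where
  "voronoi_boundary m x i = voronoi_cell m x i - voronoi_int m x i"

definition voronoi_form ::
    "'w measure \<Rightarrow> ('w \<Rightarrow> 'a::banach) \<Rightarrow> ('w \<Rightarrow> 'a) \<Rightarrow> nat \<Rightarrow> (nat \<Rightarrow> 'a) \<Rightarrow> (nat \<Rightarrow> 'w set) \<Rightarrow> bool"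
  where
  "voronoi_form M f h m x A \<longleftrightarrow>
     reduced_form M h m x A \<and>
     (\<forall>i<m. A i - f -` voronoi_cell m x i \<in> null_sets M)"

definition Mp :: "'w measure \<Rightarrow> real \<Rightarrow> ('w \<Rightarrow> 'a::banach) \<Rightarrow> 'w set \<Rightarrow> 'a \<Rightarrow> ennreal" where
  "Mp M p f A x = (\<integral>\<^sup>+w\<in>A. ennreal (norm (f w - x) powr p) \<partial>M)"

definition is_pth_mean :: "'w measure \<Rightarrow> real \<Rightarrow> ('w \<Rightarrow> 'a::banach) \<Rightarrow> 'w set \<Rightarrow> 'a \<Rightarrow> bool" where
  "is_pth_mean M p f A x \<longleftrightarrow> Mp M p f A x = (INF y. Mp M p f A y)"

definition special_voronoi_form ::
    "'w measure \<Rightarrow> real \<Rightarrow> ('w \<Rightarrow> 'a::banach) \<Rightarrow> ('w \<Rightarrow> 'a) \<Rightarrow> nat \<Rightarrow> (nat \<Rightarrow> 'a) \<Rightarrow> (nat \<Rightarrow> 'w set) \<Rightarrow> bool"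
  where
  "special_voronoi_form M p f h m x A \<longleftrightarrow>
     voronoi_form M f h m x A \<and> (\<forall>i<m. is_pth_mean M p f (A i) (x i))"

definition simple_special_voronoi_form ::
    "'w measure \<Rightarrow> real \<Rightarrow> ('w \<Rightarrow> 'a::banach) \<Rightarrow> ('w \<Rightarrow> 'a) \<Rightarrow> nat \<Rightarrow> (nat \<Rightarrow> 'a) \<Rightarrow> (nat \<Rightarrow> 'w set) \<Rightarrow> bool"
  where
  "simple_special_voronoi_form M p f h m x A \<longleftrightarrow>
     special_voronoi_form M p f h m x A \<and>
     (\<forall>i<m. f -` voronoi_boundary m x i \<inter> space M \<in> null_sets M)"

text \<open>The other description of the last condition: each piece is the preimage of the interior
  of its cell, up to a null set.\<close>

lemma simple_special_voronoi_form_pieces: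
  assumes "simple_special_voronoi_form M p f h m x A" "i < m"
  shows "AE w in M. w \<in> A i \<longleftrightarrow> f w \<in> voronoi_int m x i"
proof -
  have red: "reduced_form M h m x A"
    and cell: "\<And>j. j < m \<Longrightarrow> A j - f -` voronoi_cell m x j \<in> null_sets M"
    and bd: "\<And>j. j < m \<Longrightarrow> f -` voronoi_boundary m x j \<inter> space M \<in> null_sets M"
    using assms(1) unfolding simple_special_voronoi_form_def special_voronoi_form_def
      voronoi_form_def by auto
  have "AE w in M. w \<notin> space M - (\<Union>j<m. A j)"
    using red unfolding reduced_form_def by (intro AE_not_in) auto
  moreover have "AE w in M. \<forall>j\<in>{..<m}. w \<notin> A j - f -` voronoi_cell m x j"
    using cell by (intro AE_finite_allI AE_not_in) auto
  moreover have "AE w in M. \<forall>j\<in>{..<m}. w \<notin> f -` voronoi_boundary m x j \<inter> space M"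
    using bd by (intro AE_finite_allI AE_not_in) auto
  ultimately show ?thesis
    using AE_space
  proof eventually_elim
    case (elim w)
    have pieces: "f w \<in> voronoi_int m x j" if "w \<in> A j" "j < m" for j
      using elim that unfolding voronoi_boundary_def by auto
    obtain j where j: "j < m" "w \<in> A j"
      using elim by auto
    have "j = i" if i: "f w \<in> voronoi_int m x i"
    proof (rule ccontr)
      assume "j \<noteq> i"
      then have "norm (f w - x i) < norm (f w - x j)" "norm (f w - x j) < norm (f w - x i)"
        using i pieces[OF j(2,1)] j(1) assms(2) unfolding voronoi_int_def by auto
      then show False by simp
    qed
    then show ?case
      using pieces[of i] assms(2) j by blast
  qed
qed

end

theory Submission
  imports Defs
begin

text \<open>
  A step function with values \<open>x 0, \<dots>, x (m - 1)\<close> amounts to a family of centres together with a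
  measurable map that assigns a centre to each point.  For a minimizer, neither the centres nor the
  assignment can be changed to lower the cost \<open>\<integral>\<parallel>f - h\<parallel>\<^sup>p\<close>.  Reassigning the points that have a
  strictly closer centre gives the Voronoi form, and moving one centre shows that it is a \<open>p\<close>-th mean
  on its piece.

  The substance is that ties have measure zero.  Suppose that \<open>x i\<close> and \<open>x j\<close> are different and both
  nearest to \<open>f w\<close> for all \<open>w\<close> in a set of positive measure.  Any measurable part \<open>C\<close> of that set can
  be given to either centre at the same cost, so both assignments are optimal.  Hence \<open>x i\<close> is a mean
  on \<open>D \<union> C\<close> and also on \<open>D\<close>, where \<open>D\<close> is what \<open>x i\<close> keeps after losing \<open>C\<close>.  The cost of a
  centre on \<open>D\<close> is directionally differentiable, since the norm is smooth away from 0 and \<open>p > 1\<close>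
  makes its \<open>p\<close>-th power smooth at 0 as well.  It is therefore stationary at \<open>x i\<close>, so the convex cost
  on \<open>C\<close> is minimal at \<open>x i\<close> too (\<open>centre_of_removed_piece\<close>).  But \<open>C\<close> can be
  chosen badly for \<open>x i\<close>: the range of \<open>f\<close> is separable, so there are a point \<open>y\<close> and a \<open>C\<close> of positive
  measure on which \<open>f\<close> stays within \<open>\<parallel>x i - x j\<parallel> / 2\<close> of \<open>y\<close>, whereas tied points are at distance at
  least \<open>\<parallel>x i - x j\<parallel> / 2\<close> from \<open>x i\<close>.  Then \<open>y\<close> is a better centre on \<open>C\<close>
  (\<open>no_ties_at_nonzero_centre\<close>).

  The differentiation under the integral is done with symmetric second differences
  \<open>n (F (x + v/n) + F (x - v/n) - 2 F x)\<close>.  For convex \<open>F\<close> they are nonnegative and bounded by their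
  value at \<open>n = 1\<close>, which supplies the dominating function; when they tend to 0 and \<open>x\<close> minimizes \<open>F\<close>,
  the one-sided difference quotients of \<open>F\<close> tend to 0.
\<close>

section \<open>The p-th power of a smooth norm\<close>

lemma convex_on_norm_powr:
  fixes p :: real
  assumes "1 \<le> p"
  shows "convex_on UNIV (\<lambda>a::'a::real_normed_vector. norm a powr p)"
proof (rule convex_onI)
  have powr_conv: "((1 - t) * a + t * b) powr p \<le> (1 - t) * a powr p + t * b powr p"
    if t: "0 < t" "t < 1" and ab: "0 \<le> a" "0 \<le> b" for t a b :: real
  proof -
    have scaled: "(s * c) powr p \<le> s * c powr p" if "0 < s" "s < 1" "0 \<le> c" for s c :: real
      using that assms powr_mono'[of 1 p s] by (simp add: powr_mult mult_right_mono)
    consider "a = 0" | "b = 0" | "0 < a" "0 < b" using ab by linarith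
    then show ?thesis
    proof cases
      case 3
      then show ?thesis
        using convex_onD[OF powr_convex[OF assms], of t a b] t by simp
    qed (use scaled[of t b] scaled[of "1 - t" a] t ab assms in auto)
  qed
  fix t :: real and x y :: 'a
  assume t: "0 < t" "t < 1"
  have "norm ((1 - t) *\<^sub>R x + t *\<^sub>R y) \<le> (1 - t) * norm x + t * norm y"
    using norm_triangle_ineq[of "(1 - t) *\<^sub>R x" "t *\<^sub>R y"] t by simp
  then have "norm ((1 - t) *\<^sub>R x + t *\<^sub>R y) powr p \<le> ((1 - t) * norm x + t * norm y) powr p"
    using assms by (intro powr_mono2) auto
  also have "\<dots> \<le> (1 - t) * norm x powr p + t * norm y powr p"
    using t by (intro powr_conv) auto
  finally show "norm ((1 - t) *\<^sub>R x + t *\<^sub>R y) powr p \<le> (1 - t) * norm x powr p + t * norm y powr p" .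
qed auto

text \<open>The triangle inequality for \<open>L\<^sup>p\<close> up to a constant, which suffices to transfer
  integrability.\<close>

lemma norm_add_powr_le:
  fixes a b :: "'a::real_normed_vector"
  assumes "0 \<le> p"
  shows "norm (a + b) powr p \<le> 2 powr p * (norm a powr p + norm b powr p)"
proof -
  have "norm (a + b) \<le> 2 * max (norm a) (norm b)"
    using norm_triangle_ineq[of a b] by linarith
  then have "norm (a + b) powr p \<le> (2 * max (norm a) (norm b)) powr p"
    using assms by (intro powr_mono2) auto
  also have "\<dots> = 2 powr p * max (norm a) (norm b) powr p"
    by (simp add: powr_mult)
  also have "\<dots> \<le> 2 powr p * (norm a powr p + norm b powr p)"
    by (intro mult_left_mono) (auto simp: max_def)
  finally show ?thesis .
qed

lemma norm_diff_powr_le: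
  fixes a b :: "'a::real_normed_vector"
  assumes "0 \<le> p"
  shows "norm (a - b) powr p \<le> 2 powr p * (norm a powr p + norm b powr p)"
  using norm_add_powr_le[OF assms, of a "- b"] by simp

text \<open>
  Stationarity at a minimum is expressed by scaled symmetric differences tending to 0.  They avoid
  naming the derivative, and convexity controls them from both sides.  The step is \<open>1 / Suc n\<close>, so
  that \<open>n = 0\<close> is the full step.
\<close>

definition second_difference :: "('a::real_vector \<Rightarrow> real) \<Rightarrow> 'a \<Rightarrow> 'a \<Rightarrow> nat \<Rightarrow> real" where
  "second_difference F x v n =
     real (Suc n) * (F (x + (1 / real (Suc n)) *\<^sub>R v) + F (x - (1 / real (Suc n)) *\<^sub>R v) - 2 * F x)"

lemma convex_on_scaled_step_le:
  fixes F :: "'a::real_vector \<Rightarrow> real"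
  assumes "convex_on UNIV F"
  shows "real (Suc n) * (F (x + (1 / real (Suc n)) *\<^sub>R v) - F x) \<le> F (x + v) - F x"
proof -
  define t where "t = 1 / real (Suc n)"
  have t: "0 \<le> t" "t \<le> 1" "0 < t" by (auto simp: t_def)
  have "F ((1 - t) *\<^sub>R x + t *\<^sub>R (x + v)) \<le> (1 - t) * F x + t * F (x + v)"
    using convex_onD[OF assms, of t x "x + v"] t by simp
  moreover have "(1 - t) *\<^sub>R x + t *\<^sub>R (x + v) = x + t *\<^sub>R v"
    by (simp add: algebra_simps)
  ultimately have "F (x + t *\<^sub>R v) - F x \<le> t * (F (x + v) - F x)"
    by (simp add: algebra_simps)
  then have "(F (x + t *\<^sub>R v) - F x) / t \<le> F (x + v) - F x"
    using t by (simp add: divide_le_eq mult.commute)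
  then show ?thesis by (simp add: t_def mult.commute)
qed

lemma second_difference_bounds:
  assumes "convex_on UNIV F"
  shows "0 \<le> second_difference F x v n"
    and "second_difference F x v n \<le> F (x + v) + F (x - v) - 2 * F x"
proof -
  define u where "u = (1 / real (Suc n)) *\<^sub>R v"
  have "F x \<le> (1/2) * F (x + u) + (1/2) * F (x - u)"
    using convex_onD[OF assms, of "1/2" "x + u" "x - u"]
    by (simp add: algebra_simps flip: scaleR_add_left)
  then show "0 \<le> second_difference F x v n"
    unfolding second_difference_def u_def[symmetric] by (intro mult_nonneg_nonneg) auto
  show "second_difference F x v n \<le> F (x + v) + F (x - v) - 2 * F x"
    using convex_on_scaled_step_le[OF assms, of n x v] convex_on_scaled_step_le[OF assms, of n x "- v"]
    unfolding second_difference_def by (simp add: algebra_simps)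
qed

lemma second_difference_tendsto_0:
  fixes F :: "'a::real_normed_vector \<Rightarrow> real"
  assumes "((\<lambda>t. F (x + t *\<^sub>R v)) has_real_derivative d) (at 0)"
  shows "second_difference F x v \<longlonglongrightarrow> 0"
proof -
  define g where "g t = F (x + t *\<^sub>R v)" for t
  have lim: "((\<lambda>t. (g t - g 0) / t) \<longlongrightarrow> d) (at 0)"
    using assms unfolding DERIV_def g_def by simp
  have to0: "(\<lambda>n. 1 / real (Suc n)) \<longlonglongrightarrow> 0"
    using LIMSEQ_inverse_real_of_nat by (simp add: inverse_eq_divide)
  have "filterlim (\<lambda>n. 1 / real (Suc n)) (at 0) sequentially"
    using to0 by (auto simp: filterlim_at)
  then have plus: "(\<lambda>n. (g (1 / real (Suc n)) - g 0) / (1 / real (Suc n))) \<longlonglongrightarrow> d"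
    by (rule filterlim_compose[OF lim])
  have "filterlim (\<lambda>n. - (1 / real (Suc n))) (at 0) sequentially"
    using tendsto_minus[OF to0] by (auto simp: filterlim_at)
  then have minus: "(\<lambda>n. (g (- (1 / real (Suc n))) - g 0) / (- (1 / real (Suc n)))) \<longlonglongrightarrow> d"
    by (rule filterlim_compose[OF lim])
  have "second_difference F x v = (\<lambda>n. (g (1 / real (Suc n)) - g 0) / (1 / real (Suc n))
      - (g (- (1 / real (Suc n))) - g 0) / (- (1 / real (Suc n))))"
    unfolding second_difference_def g_def by (rule ext) (simp add: algebra_simps)
  then show ?thesis
    using tendsto_diff[OF plus minus] by simp
qed

text \<open>
  Away from 0 this is the chain rule.  At 0 the difference quotient has modulus
  \<open>\<bar>t\<bar> powr (p - 1) * \<parallel>v\<parallel> powr p\<close>, which tends to 0 because \<open>p > 1\<close>, although the norm itself has a corner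
  there.
\<close>

lemma norm_powr_has_directional_derivative:
  fixes x v :: "'a::real_normed_vector"
  assumes "1 < p" and "x \<noteq> 0 \<Longrightarrow> gateaux_differentiable_at norm x"
  shows "\<exists>d. ((\<lambda>t. norm (x + t *\<^sub>R v) powr p) has_real_derivative d) (at 0)"
proof (cases "x = 0")
  case True
  have "((\<lambda>t::real. \<bar>t\<bar> powr (p - 1)) \<longlongrightarrow> 0) (at 0)"
  proof -
    have "((\<lambda>t::real. \<bar>t\<bar>) \<longlongrightarrow> 0) (at 0)"
      by (rule tendsto_rabs_zero) (rule tendsto_ident_at)
    then show ?thesis
      using assms(1) tendsto_powr'[of abs "0::real" "at 0" "\<lambda>_. p - 1" "p - 1"] by simp
  qed
  then have "((\<lambda>t::real. \<bar>t\<bar> powr (p - 1) * norm v powr p) \<longlongrightarrow> 0) (at 0)"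
    by (rule tendsto_mult_left_zero)
  then have "((\<lambda>t::real. (\<bar>t\<bar> * norm v) powr p / t) \<longlongrightarrow> 0) (at 0)"
  proof (rule Lim_null_comparison[rotated])
    show "\<forall>\<^sub>F t in at 0. norm ((\<bar>t\<bar> * norm v) powr p / t) \<le> \<bar>t\<bar> powr (p - 1) * norm v powr p"
      by (auto simp: eventually_at_filter powr_mult powr_diff)
  qed
  then show ?thesis
    using True assms(1) by (auto simp: DERIV_def)
next
  case False
  then obtain D where "((\<lambda>t. norm (x + t *\<^sub>R v)) has_vector_derivative D v) (at 0)"
    using assms(2) unfolding gateaux_differentiable_at_def by auto
  then have "((\<lambda>t. norm (x + t *\<^sub>R v)) has_real_derivative D v) (at 0)"
    by (simp add: has_real_derivative_iff_has_vector_derivative)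
  then show ?thesis
    using False by (intro exI) (rule DERIV_fun_powr, auto)
qed

text \<open>
  If \<open>x\<close> minimizes both \<open>F\<close> and \<open>F + G\<close>, moving from \<open>x\<close> towards \<open>x + v\<close> raises \<open>F\<close> by less than any
  multiple of the step, so \<open>G\<close> cannot decrease at a linear rate; convexity of \<open>G\<close> turns this into a
  comparison with the endpoint \<open>x + v\<close>.  Without smoothness this fails: on the line, 0 minimizes
  \<open>\<bar>t\<bar>\<close> and \<open>\<bar>t\<bar> - t\<close> but not \<open>- t\<close>.
\<close>

lemma minimizer_of_convex_summand:
  fixes F G :: "'a::real_vector \<Rightarrow> real"
  assumes conv: "convex_on UNIV G"
    and smooth: "second_difference F x v \<longlonglongrightarrow> 0"
    and min_F: "\<And>y. F x \<le> F y" and min_sum: "\<And>y. F x + G x \<le> F y + G y"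
  shows "G x \<le> G (x + v)"
proof -
  have "- second_difference F x v n \<le> G (x + v) - G x" for n
  proof -
    define u where "u = (1 / real (Suc n)) *\<^sub>R v"
    have "- (F (x + u) + F (x - u) - 2 * F x) \<le> G (x + u) - G x"
      using min_F[of "x - u"] min_sum[of "x + u"] by linarith
    then have "real (Suc n) * - (F (x + u) + F (x - u) - 2 * F x) \<le> real (Suc n) * (G (x + u) - G x)"
      by (intro mult_left_mono) auto
    then show ?thesis
      using convex_on_scaled_step_le[OF conv, of n x v]
      unfolding second_difference_def u_def by linarith
  qed
  then have "- 0 \<le> G (x + v) - G x"
    by (intro LIMSEQ_le_const2[OF tendsto_minus[OF smooth]]) auto
  then show ?thesis by simp
qed

section \<open>Strongly measurable functions\<close>

lemma strongly_measurable_simple_function: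
  "simple_function M g \<Longrightarrow> strongly_measurable M g"
  unfolding strongly_measurable_def by (intro exI[of _ "\<lambda>_. g"]) auto

lemma borel_measurable_norm_diff:
  fixes f g :: "'w \<Rightarrow> 'a::banach"
  assumes "strongly_measurable M f" "strongly_measurable M g"
  shows "(\<lambda>w. norm (f w - g w)) \<in> borel_measurable M"
proof -
  obtain s where s: "\<And>n. simple_function M (s n)" "\<And>w. w \<in> space M \<Longrightarrow> (\<lambda>n. s n w) \<longlonglongrightarrow> f w"
    using assms(1) unfolding strongly_measurable_def by auto
  obtain t where t: "\<And>n. simple_function M (t n)" "\<And>w. w \<in> space M \<Longrightarrow> (\<lambda>n. t n w) \<longlonglongrightarrow> g w"
    using assms(2) unfolding strongly_measurable_def by auto
  have "simple_function M (\<lambda>w. norm (s n w - t n w))" for n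
    using s(1) t(1) by (rule simple_function_compose2)
  then show ?thesis
    by (rule borel_measurable_LIMSEQ_metric[where f="\<lambda>n w. norm (s n w - t n w)",
          OF borel_measurable_simple_function])
      (intro tendsto_norm tendsto_diff s(2) t(2))
qed

lemma borel_measurable_norm_diff_const:
  fixes f :: "'w \<Rightarrow> 'a::banach"
  assumes "strongly_measurable M f"
  shows "(\<lambda>w. norm (f w - x)) \<in> borel_measurable M"
  by (rule borel_measurable_norm_diff[OF assms strongly_measurable_simple_function[OF simple_function_const]])

text \<open>
  The values of the approximating simple functions are countably many and come arbitrarily close to
  every value of \<open>f\<close>.  This replaces separability of the space.
\<close>

lemma strongly_measurable_separable_range:
  fixes f :: "'w \<Rightarrow> 'a::banach"
  assumes "strongly_measurable M f"
  obtains S where "countable S" "\<And>w e. w \<in> space M \<Longrightarrow> 0 < e \<Longrightarrow> \<exists>y\<in>S. norm (f w - y) < e"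
proof -
  obtain s where s: "\<And>n. simple_function M (s n)"
      "\<And>w. w \<in> space M \<Longrightarrow> (\<lambda>n. s n w) \<longlonglongrightarrow> f w"
    using assms unfolding strongly_measurable_def by auto
  show thesis
  proof
    show "countable (\<Union>n. s n ` space M)"
      using simple_functionD(1)[OF s(1)] by (simp add: countable_finite)
    fix w and e :: real assume we: "w \<in> space M" "0 < e"
    then obtain n where "norm (s n w - f w) < e"
      using LIMSEQ_D[OF s(2)] by blast
    then have "norm (f w - s n w) < e"
      by (simp add: norm_minus_commute)
    then show "\<exists>y\<in>(\<Union>n. s n ` space M). norm (f w - y) < e"
      using we by blast
  qed
qed

section \<open>The cost of a single centre\<close>

text \<open>
  The real-valued counterpart of \<open>Mp\<close>, to which convexity and dominated convergence apply directly;
  it is meaningful where the integrand is integrable.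
\<close>

definition centre_cost :: "'w measure \<Rightarrow> real \<Rightarrow> ('w \<Rightarrow> 'a::banach) \<Rightarrow> 'w set \<Rightarrow> 'a \<Rightarrow> real" where
  "centre_cost M p f D y = (LINT w:D|M. norm (f w - y) powr p)"

lemma set_integrable_norm_diff_powr:
  fixes f :: "'w \<Rightarrow> 'a::banach"
  assumes "f \<in> Lp_space M p" "0 \<le> p" "D \<in> sets M" "emeasure M D < \<infinity>"
  shows "set_integrable M D (\<lambda>w. norm (f w - y) powr p)"
  unfolding set_integrable_def
proof (rule Bochner_Integration.integrable_bound)
  have "integrable M (\<lambda>w. norm (f w) powr p)" "strongly_measurable M f"
    using assms(1) by (auto simp: Lp_space_def)
  then show "integrable M (\<lambda>w. 2 powr p * (norm (f w) powr p + norm y powr p * indicator D w))"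
    using assms(3,4) by (intro integrable_mult_right Bochner_Integration.integrable_add
        integrable_real_indicator) auto
  have [measurable]: "(\<lambda>w. norm (f w - y)) \<in> borel_measurable M"
    using \<open>strongly_measurable M f\<close> by (rule borel_measurable_norm_diff_const)
  show "(\<lambda>w. indicat_real D w *\<^sub>R norm (f w - y) powr p) \<in> borel_measurable M"
    using assms(3) by measurable
  show "AE w in M. norm (indicat_real D w *\<^sub>R norm (f w - y) powr p)
      \<le> norm (2 powr p * (norm (f w) powr p + norm y powr p * indicator D w))"
    using norm_diff_powr_le[OF assms(2), of "f _" y] by (intro AE_I2) (auto split: split_indicator)
qed

lemma convex_on_centre_cost:
  fixes f :: "'w \<Rightarrow> 'a::banach"
  assumes "1 \<le> p" "\<And>y. set_integrable M D (\<lambda>w. norm (f w - y) powr p)"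
  shows "convex_on UNIV (centre_cost M p f D)"
proof (rule convex_onI)
  fix t :: real and x y :: 'a
  assume t: "0 < t" "t < 1"
  have pointwise: "norm (f w - ((1 - t) *\<^sub>R x + t *\<^sub>R y)) powr p
      \<le> (1 - t) * norm (f w - x) powr p + t * norm (f w - y) powr p" for w
  proof -
    have "f w - ((1 - t) *\<^sub>R x + t *\<^sub>R y) = (1 - t) *\<^sub>R (f w - x) + t *\<^sub>R (f w - y)"
      by (simp add: algebra_simps)
    then show ?thesis
      using convex_onD[OF convex_on_norm_powr[OF assms(1)], of t "f w - x" "f w - y"] t by simp
  qed
  have "centre_cost M p f D ((1 - t) *\<^sub>R x + t *\<^sub>R y)
      \<le> (LINT w:D|M. (1 - t) * norm (f w - x) powr p + t * norm (f w - y) powr p)"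
    unfolding centre_cost_def
    by (intro set_integral_mono assms set_integral_add pointwise set_integrable_mult_right)
  also have "\<dots> = (1 - t) * centre_cost M p f D x + t * centre_cost M p f D y"
    unfolding centre_cost_def
    by (subst set_integral_add) (auto intro!: assms set_integrable_mult_right)
  finally show "centre_cost M p f D ((1 - t) *\<^sub>R x + t *\<^sub>R y)
      \<le> (1 - t) * centre_cost M p f D x + t * centre_cost M p f D y" .
qed auto

text \<open>
  Pointwise, the second differences of the integrand tend to 0 by smoothness; they are dominated by
  the full-step second difference by convexity.
\<close>

lemma second_difference_centre_cost_tendsto_0:
  fixes f :: "'w \<Rightarrow> 'a::banach"
  assumes gateaux: "\<And>x::'a. x \<noteq> 0 \<Longrightarrow> gateaux_differentiable_at norm x"
    and p: "1 < p" and int: "\<And>y. set_integrable M D (\<lambda>w. norm (f w - y) powr p)"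
  shows "second_difference (centre_cost M p f D) x v \<longlonglongrightarrow> 0"
proof -
  define N where "N a = norm a powr p" for a :: 'a
  have N_conv: "convex_on UNIV N"
    unfolding N_def using p by (intro convex_on_norm_powr) simp
  \<comment> \<open>The centre moves along \<open>v\<close>, so \<open>f w - x\<close> moves along \<open>- v\<close>.\<close>
  define \<phi> where "\<phi> n w = second_difference N (f w - x) (- v) n" for n w
  have int_N: "set_integrable M D (\<lambda>w. N (f w - y))" for y
    unfolding N_def by (rule int)
  have int_shift: "set_integrable M D (\<lambda>w. N (f w - x + u))" for u
    using int_N[of "x - u"] by (simp add: algebra_simps)
  have int_shift': "set_integrable M D (\<lambda>w. N (f w - x - u))" for u
    using int_shift[of "- u"] by simp
  have int_\<phi>: "set_integrable M D (\<phi> n)" for n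
    unfolding \<phi>_def second_difference_def
    by (intro set_integrable_mult_right set_integral_diff set_integral_add int_N int_shift int_shift')
  have eq: "second_difference (centre_cost M p f D) x v n = (LINT w:D|M. \<phi> n w)" for n
  proof -
    define u where "u = (1 / real (Suc n)) *\<^sub>R v"
    have "(LINT w:D|M. \<phi> n w) = real (Suc n) *
        (LINT w:D|M. N (f w - x - u) + N (f w - x + u) - 2 * N (f w - x))"
      unfolding \<phi>_def second_difference_def u_def by simp
    also have "\<dots> = real (Suc n) *
        ((LINT w:D|M. N (f w - x - u)) + (LINT w:D|M. N (f w - x + u)) - 2 * (LINT w:D|M. N (f w - x)))"
      by (subst set_integral_diff set_integral_add;
          (intro set_integral_add set_integrable_mult_right int_N int_shift int_shift')?)+ simp
    finally show ?thesis
      unfolding second_difference_def centre_cost_def u_def N_def by (simp add: algebra_simps)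
  qed
  have "(\<lambda>n. LINT w|M. indicator D w *\<^sub>R \<phi> n w) \<longlonglongrightarrow> (LINT w|M. 0)"
  proof (rule integral_dominated_convergence)
    show "integrable M (\<lambda>w. indicator D w *\<^sub>R (N (f w - x - v) + N (f w - x + v) - 2 * N (f w - x)))"
      unfolding set_integrable_def[symmetric]
      by (intro set_integral_diff set_integral_add set_integrable_mult_right int_N int_shift int_shift')
    show "(\<lambda>w. indicator D w *\<^sub>R \<phi> n w) \<in> borel_measurable M" for n
      using int_\<phi>[of n] unfolding set_integrable_def by auto
    show "AE w in M. norm (indicator D w *\<^sub>R \<phi> n w)
        \<le> indicator D w *\<^sub>R (N (f w - x - v) + N (f w - x + v) - 2 * N (f w - x))" for n
      using second_difference_bounds[OF N_conv, where v="- v"] unfolding \<phi>_def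
      by (intro AE_I2) (auto split: split_indicator)
    show "AE w in M. (\<lambda>n. indicator D w *\<^sub>R \<phi> n w) \<longlonglongrightarrow> 0"
    proof (intro AE_I2)
      fix w
      obtain d where "((\<lambda>t. N (f w - x + t *\<^sub>R (- v))) has_real_derivative d) (at 0)"
        using norm_powr_has_directional_derivative[OF p gateaux] unfolding N_def by blast
      then have "(\<lambda>n. \<phi> n w) \<longlonglongrightarrow> 0"
        unfolding \<phi>_def by (rule second_difference_tendsto_0)
      from tendsto_scaleR[OF tendsto_const this]
      show "(\<lambda>n. indicat_real D w *\<^sub>R \<phi> n w) \<longlonglongrightarrow> 0"
        by simp
    qed
  qed auto
  then show ?thesis
    unfolding eq set_lebesgue_integral_def by simp
qed

text \<open>
  Costs add over disjoint pieces, so this is \<open>minimizer_of_convex_summand\<close> for the costs on \<open>D\<close> and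
  \<open>C\<close>.  Finite measure makes both costs finite at every centre.
\<close>

lemma centre_of_removed_piece:
  fixes f :: "'w \<Rightarrow> 'a::banach"
  assumes gateaux: "\<And>x::'a. x \<noteq> 0 \<Longrightarrow> gateaux_differentiable_at norm x"
    and p: "1 < p" and f: "f \<in> Lp_space M p"
    and sets: "D \<in> sets M" "C \<in> sets M" "D \<inter> C = {}"
    and fin: "emeasure M D < \<infinity>" "emeasure M C < \<infinity>"
    and min: "\<And>y. centre_cost M p f D x \<le> centre_cost M p f D y"
      "\<And>y. centre_cost M p f (D \<union> C) x \<le> centre_cost M p f (D \<union> C) y"
  shows "centre_cost M p f C x \<le> centre_cost M p f C y"
proof -
  have int: "set_integrable M D (\<lambda>w. norm (f w - y) powr p)"
      "set_integrable M C (\<lambda>w. norm (f w - y) powr p)" for y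
    using p f sets fin by (auto intro!: set_integrable_norm_diff_powr)
  have split: "centre_cost M p f (D \<union> C) y = centre_cost M p f D y + centre_cost M p f C y" for y
    unfolding centre_cost_def using sets(3) int by (rule set_integral_Un)
  have "centre_cost M p f C x \<le> centre_cost M p f C (x + (y - x))"
  proof (rule minimizer_of_convex_summand)
    show "convex_on UNIV (centre_cost M p f C)"
      using p int by (intro convex_on_centre_cost) auto
    show "second_difference (centre_cost M p f D) x (y - x) \<longlonglongrightarrow> 0"
      using gateaux p int(1) by (rule second_difference_centre_cost_tendsto_0)
  qed (use min split in auto)
  then show ?thesis by simp
qed

section \<open>Optimal assignments\<close>

definition assignment_into :: "nat \<Rightarrow> 'w measure \<Rightarrow> ('w \<Rightarrow> nat) \<Rightarrow> bool" where
  "assignment_into m M c \<longleftrightarrow> simple_function M c \<and> (\<forall>w\<in>space M. c w < m)"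

text \<open>
  Minimality over all step functions of finite cost that take at most \<open>m\<close> values.  The centres \<open>x\<close> and the
  assignment \<open>c\<close> are kept apart, because the proof varies one while it fixes the other.
\<close>

definition optimal_assignment ::
    "'w measure \<Rightarrow> real \<Rightarrow> ('w \<Rightarrow> 'a::banach) \<Rightarrow> nat \<Rightarrow> (nat \<Rightarrow> 'a) \<Rightarrow> ('w \<Rightarrow> nat) \<Rightarrow> bool" where
  "optimal_assignment M p f m x c \<longleftrightarrow>
     assignment_into m M c \<and> integrable M (\<lambda>w. norm (f w - x (c w)) powr p) \<and>
     (\<forall>y d. assignment_into m M d \<longrightarrow> integrable M (\<lambda>w. norm (f w - y (d w)) powr p) \<longrightarrow>
        (LINT w|M. norm (f w - x (c w)) powr p) \<le> (LINT w|M. norm (f w - y (d w)) powr p))"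

lemma assignment_into_If:
  assumes "assignment_into m M c" "j < m" "{w \<in> space M. P w} \<in> sets M"
  shows "assignment_into m M (\<lambda>w. if P w then j else c w)"
  using assms unfolding assignment_into_def by (auto intro!: simple_function_If)

lemma borel_measurable_norm_diff_assignment:
  fixes x :: "nat \<Rightarrow> 'a::banach"
  assumes "strongly_measurable M f" "assignment_into m M c"
  shows "(\<lambda>w. norm (f w - x (c w))) \<in> borel_measurable M"
proof (rule borel_measurable_norm_diff[OF assms(1) strongly_measurable_simple_function])
  show "simple_function M (\<lambda>w. x (c w))"
    using assms(2) unfolding assignment_into_def by (blast intro: simple_function_compose1[of M c x])
qed

text \<open>
  Reassign to centre \<open>j\<close> the points that are strictly closer to it: the cost decreases pointwise, and
  by optimality its integral does not, so this happens only on a null set.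
\<close>

lemma optimal_assignment_nearest:
  assumes f: "strongly_measurable M f" and p: "0 < p"
    and opt: "optimal_assignment M p f m x c"
  shows "AE w in M. \<forall>j<m. norm (f w - x (c w)) \<le> norm (f w - x j)"
proof -
  note [measurable] = borel_measurable_norm_diff_const[OF f]
  have c: "assignment_into m M c"
    and int: "integrable M (\<lambda>w. norm (f w - x (c w)) powr p)"
    and le: "\<And>y d. assignment_into m M d \<Longrightarrow> integrable M (\<lambda>w. norm (f w - y (d w)) powr p) \<Longrightarrow>
        (LINT w|M. norm (f w - x (c w)) powr p) \<le> (LINT w|M. norm (f w - y (d w)) powr p)"
    using opt unfolding optimal_assignment_def by auto
  note [measurable] = borel_measurable_norm_diff_assignment[OF f c]
  have "AE w in M. norm (f w - x (c w)) \<le> norm (f w - x j)" if j: "j < m" for j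
  proof -
    define d where "d w = (if norm (f w - x j) < norm (f w - x (c w)) then j else c w)" for w
    have d: "assignment_into m M d"
      unfolding d_def using c j by (rule assignment_into_If) measurable
    note [measurable] = borel_measurable_norm_diff_assignment[OF f d]
    have closer: "norm (f w - x (d w)) powr p \<le> norm (f w - x (c w)) powr p" for w
      using p by (auto simp: d_def intro!: powr_mono2)
    have int_d: "integrable M (\<lambda>w. norm (f w - x (d w)) powr p)"
      using int by (rule Bochner_Integration.integrable_bound) (use closer in auto)
    have "(LINT w|M. norm (f w - x (c w)) powr p - norm (f w - x (d w)) powr p) \<le> 0"
      using le[OF d int_d] int int_d by (simp add: Bochner_Integration.integral_diff)
    moreover have "0 \<le> (LINT w|M. norm (f w - x (c w)) powr p - norm (f w - x (d w)) powr p)"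
      using closer by (intro integral_nonneg_AE) auto
    ultimately have "AE w in M. norm (f w - x (c w)) powr p - norm (f w - x (d w)) powr p = 0"
      using int int_d closer by (subst integral_nonneg_eq_0_iff_AE[symmetric]) auto
    then show ?thesis
    proof eventually_elim
      case (elim w)
      show ?case
      proof (rule ccontr)
        assume "\<not> ?case"
        then have "norm (f w - x j) powr p < norm (f w - x (c w)) powr p" "d w = j"
          using p by (auto simp: d_def intro!: powr_less_mono2)
        then show False using elim by simp
      qed
    qed
  qed
  then have "AE w in M. \<forall>j\<in>{..<m}. norm (f w - x (c w)) \<le> norm (f w - x j)"
    by (intro AE_finite_allI) auto
  then show ?thesis by (simp add: Ball_def)
qed

lemma optimal_assignment_switch_ties:
  assumes "optimal_assignment M p f m x c" "assignment_into m M d"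
    and "\<And>w. norm (f w - x (d w)) = norm (f w - x (c w))"
  shows "optimal_assignment M p f m x d"
  using assms unfolding optimal_assignment_def by simp

text \<open>
  Only the centre \<open>i\<close> is moved, to \<open>y\<close>; the cost outside the piece \<open>D\<close> does not change and cancels.
\<close>

lemma optimal_assignment_centre:
  fixes x :: "nat \<Rightarrow> 'a::banach"
  assumes opt: "optimal_assignment M p f m x c"
    and D: "D = {w \<in> space M. c w = i}"
    and y: "set_integrable M D (\<lambda>w. norm (f w - y) powr p)"
  shows "set_integrable M D (\<lambda>w. norm (f w - x i) powr p)"
    and "centre_cost M p f D (x i) \<le> centre_cost M p f D y"
proof -
  have c: "assignment_into m M c"
    and int: "integrable M (\<lambda>w. norm (f w - x (c w)) powr p)"
    and le: "\<And>y d. assignment_into m M d \<Longrightarrow> integrable M (\<lambda>w. norm (f w - y (d w)) powr p) \<Longrightarrow>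
        (LINT w|M. norm (f w - x (c w)) powr p) \<le> (LINT w|M. norm (f w - y (d w)) powr p)"
    using opt unfolding optimal_assignment_def by auto
  have "c \<in> measurable M (count_space UNIV)"
    using c unfolding assignment_into_def by (auto intro: measurable_simple_function)
  then have D_sets: "D \<in> sets M"
    unfolding D by measurable
  define R where "R w = norm (f w - x (c w)) powr p" for w
  define e where "e z w = norm (f w - z) powr p" for z w
  have R_int: "set_integrable M E R" if "E \<in> sets M" for E
    using integrable_mult_indicator[OF that int] unfolding R_def set_integrable_def .
  have e_x: "set_integrable M D (e (x i))"
  proof -
    have eq: "(\<lambda>w. indicator D w *\<^sub>R e (x i) w) = (\<lambda>w. indicator D w *\<^sub>R R w)"
      by (auto simp: D R_def e_def fun_eq_iff indicator_def)
    then show ?thesis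
      using R_int[OF D_sets] unfolding set_integrable_def by (simp only: eq)
  qed
  then show "set_integrable M D (\<lambda>w. norm (f w - x i) powr p)"
    unfolding e_def .
  \<comment> \<open>The case \<open>z = x i\<close> decomposes the original cost in the same way.\<close>
  have patched: "integrable M (\<lambda>w. norm (f w - (x(i := z)) (c w)) powr p)
      \<and> (LINT w|M. norm (f w - (x(i := z)) (c w)) powr p)
        = centre_cost M p f D z + (LINT w:space M - D|M. R w)"
    if z: "set_integrable M D (e z)" for z
  proof -
    have eq: "norm (f w - (x(i := z)) (c w)) powr p
        = indicator D w *\<^sub>R e z w + indicator (space M - D) w *\<^sub>R R w" if "w \<in> space M" for w
      using that by (auto simp: D R_def e_def)
    have "integrable M (\<lambda>w. indicator D w *\<^sub>R e z w + indicator (space M - D) w *\<^sub>R R w)"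
      using z R_int[of "space M - D"] D_sets unfolding set_integrable_def by (intro Bochner_Integration.integrable_add) auto
    moreover have "(LINT w|M. indicator D w *\<^sub>R e z w + indicator (space M - D) w *\<^sub>R R w)
        = centre_cost M p f D z + (LINT w:space M - D|M. R w)"
      using z R_int[of "space M - D"] D_sets unfolding set_integrable_def centre_cost_def set_lebesgue_integral_def e_def
      by (intro Bochner_Integration.integral_add) auto
    moreover note Bochner_Integration.integrable_cong[OF refl eq, of M "\<lambda>w. w"]
      Bochner_Integration.integral_cong[OF refl eq, of M "\<lambda>w. w"]
    ultimately show ?thesis
      by metis
  qed
  show "centre_cost M p f D (x i) \<le> centre_cost M p f D y"
  proof -
    have "set_integrable M D (e y)"
      using y unfolding e_def .
    note new = patched[OF this] and old = patched[OF e_x]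
    have "(LINT w|M. norm (f w - x (c w)) powr p) \<le> (LINT w|M. norm (f w - (x(i := y)) (c w)) powr p)"
      using new by (intro le c) blast
    then show ?thesis
      using new old unfolding fun_upd_triv by linarith
  qed
qed

section \<open>Ties have measure zero\<close>

text \<open>
  The assumption \<open>x i \<noteq> 0\<close> forces the piece of \<open>x i\<close> to have finite measure, since a step function in
  \<open>L\<^sup>p\<close> can only take the value 0 on a set of infinite measure.
\<close>

lemma no_ties_at_nonzero_centre:
  fixes f :: "'w \<Rightarrow> 'a::banach"
  assumes gateaux: "\<And>x::'a. x \<noteq> 0 \<Longrightarrow> gateaux_differentiable_at norm x"
    and p: "1 < p" and f: "f \<in> Lp_space M p"
    and opt: "optimal_assignment M p f m x c"
    and ij: "i < m" "j < m" "x i \<noteq> x j" "x i \<noteq> 0"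
  shows "AE w in M. \<not> (norm (f w - x i) = norm (f w - x j) \<and> norm (f w - x i) = norm (f w - x (c w)))"
proof (rule ccontr)
  assume not_null: "\<not> ?thesis"
  have f_meas: "strongly_measurable M f" and f_int: "integrable M (\<lambda>w. norm (f w) powr p)"
    using f by (auto simp: Lp_space_def)
  note [measurable] = borel_measurable_norm_diff_const[OF f_meas]
  have c: "assignment_into m M c"
    and int: "integrable M (\<lambda>w. norm (f w - x (c w)) powr p)"
    using opt unfolding optimal_assignment_def by auto
  note [measurable] = borel_measurable_norm_diff_assignment[OF f_meas c]
  have [measurable]: "c \<in> measurable M (count_space UNIV)"
    using c unfolding assignment_into_def by (auto intro: measurable_simple_function)
  define r where "r = norm (x i - x j) / 2"
  have r: "0 < r" using ij by (simp add: r_def)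
  define T where "T w \<longleftrightarrow> norm (f w - x i) = norm (f w - x j) \<and> norm (f w - x i) = norm (f w - x (c w))" for w
  \<comment> \<open>A point equidistant from two centres is at least half their distance away from them.\<close>
  have far: "r \<le> norm (f w - x i)" if "T w" for w
    using that norm_triangle_ineq4[of "f w - x j" "f w - x i"] by (simp add: T_def r_def)
  \<comment> \<open>Countably many balls of radius \<open>r\<close> cover the range of \<open>f\<close>, so one of them meets the ties in
    positive measure.\<close>
  obtain S where S: "countable S" "\<And>w e. w \<in> space M \<Longrightarrow> 0 < e \<Longrightarrow> \<exists>y\<in>S. norm (f w - y) < e"
    using strongly_measurable_separable_range[OF f_meas] by blast
  have "\<exists>y\<in>S. \<not> (AE w in M. \<not> (T w \<and> norm (f w - y) < r))"
  proof (rule ccontr)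
    assume "\<not> ?thesis"
    then have "\<forall>y\<in>S. AE w in M. \<not> (T w \<and> norm (f w - y) < r)"
      by blast
    then have "AE w in M. \<forall>y\<in>S. \<not> (T w \<and> norm (f w - y) < r)"
      unfolding AE_ball_countable[OF S(1)] .
    then have "AE w in M. \<not> T w"
      using AE_space
    proof eventually_elim
      case (elim w)
      obtain y where "y \<in> S" "norm (f w - y) < r"
        using S(2)[OF elim(2) r] by blast
      then show ?case using elim(1) by blast
    qed
    then show False using not_null unfolding T_def by simp
  qed
  then obtain y where y: "\<not> (AE w in M. \<not> (T w \<and> norm (f w - y) < r))" by blast
  define C where "C = {w \<in> space M. T w \<and> norm (f w - y) < r}"
  have C_sets [measurable]: "C \<in> sets M"
    unfolding C_def T_def by measurable
  have C_pos: "\<not> (AE w in M. w \<notin> C)"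
  proof
    assume "AE w in M. w \<notin> C"
    then have "AE w in M. \<not> (T w \<and> norm (f w - y) < r)"
      using AE_space by eventually_elim (simp add: C_def)
    then show False using y by simp
  qed
  define D where "D = {w \<in> space M. c w = i} - C"
  have D_sets [measurable]: "D \<in> sets M"
    unfolding D_def by measurable
  \<comment> \<open>On \<open>C\<close> the integrable cost is at least \<open>r powr p > 0\<close>.\<close>
  have C_fin: "emeasure M C < \<infinity>"
  proof -
    have "integrable M (\<lambda>w. indicator C w *\<^sub>R (1::real))"
    proof (rule Bochner_Integration.integrable_bound)
      show "integrable M (\<lambda>w. norm (f w - x (c w)) powr p / r powr p)"
        using int by simp
      show "AE w in M. norm (indicator C w *\<^sub>R (1::real)) \<le> norm (norm (f w - x (c w)) powr p / r powr p)"
      proof (intro AE_I2)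
        fix w
        have "r powr p \<le> norm (f w - x (c w)) powr p" if "w \<in> C"
          using far[of w] that p r by (intro powr_mono2) (auto simp: C_def T_def)
        then show "norm (indicator C w *\<^sub>R (1::real)) \<le> norm (norm (f w - x (c w)) powr p / r powr p)"
          using r by (cases "w \<in> C") auto
      qed
    qed measurable
    then show ?thesis by (auto simp: integrable_indicator_iff less_top)
  qed
  \<comment> \<open>On \<open>D\<close> the assigned centre is the nonzero constant \<open>x i\<close>, whose \<open>p\<close>-th power is bounded by an
    integrable function.\<close>
  have D_fin: "emeasure M D < \<infinity>"
  proof -
    have "integrable M (\<lambda>w. indicator D w *\<^sub>R (1::real))"
    proof (rule Bochner_Integration.integrable_bound)
      show "integrable M (\<lambda>w. 2 powr p * (norm (f w) powr p + norm (f w - x (c w)) powr p) / norm (x i) powr p)"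
        using f_int int by (intro integrable_divide integrable_mult_right Bochner_Integration.integrable_add)
      show "AE w in M. norm (indicator D w *\<^sub>R (1::real))
          \<le> norm (2 powr p * (norm (f w) powr p + norm (f w - x (c w)) powr p) / norm (x i) powr p)"
      proof (intro AE_I2)
        fix w
        have "norm (x i) powr p \<le> 2 powr p * (norm (f w) powr p + norm (f w - x (c w)) powr p)"
          if "w \<in> D"
          using norm_diff_powr_le[of p "f w" "f w - x i"] p that by (simp add: D_def)
        then show "norm (indicator D w *\<^sub>R (1::real))
            \<le> norm (2 powr p * (norm (f w) powr p + norm (f w - x (c w)) powr p) / norm (x i) powr p)"
          using ij by (cases "w \<in> D") auto
      qed
    qed measurable
    then show ?thesis by (auto simp: integrable_indicator_iff less_top)
  qed
  have switch: "optimal_assignment M p f m x (\<lambda>w. if w \<in> C then l else c w)" if "l = i \<or> l = j" for l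
    using opt
  proof (rule optimal_assignment_switch_ties)
    show "assignment_into m M (\<lambda>w. if w \<in> C then l else c w)"
      using c ij that by (intro assignment_into_If) auto
    show "norm (f w - x (if w \<in> C then l else c w)) = norm (f w - x (c w))" for w
      using that by (auto simp: C_def T_def)
  qed
  have int_D: "set_integrable M D (\<lambda>w. norm (f w - z) powr p)"
    and int_C: "set_integrable M C (\<lambda>w. norm (f w - z) powr p)" for z
    using f p C_fin D_fin by (auto intro!: set_integrable_norm_diff_powr)
  have "centre_cost M p f C (x i) \<le> centre_cost M p f C y"
  proof (rule centre_of_removed_piece[OF gateaux p f])
    \<comment> \<open>Giving \<open>C\<close> to \<open>j\<close> leaves \<open>D\<close> to \<open>i\<close>; giving it to \<open>i\<close> leaves \<open>D \<union> C\<close>.\<close>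
    show "centre_cost M p f D (x i) \<le> centre_cost M p f D z" for z
    proof (rule optimal_assignment_centre(2)[OF switch[of j] _ int_D])
      show "D = {w \<in> space M. (if w \<in> C then j else c w) = i}"
        using ij by (auto simp: D_def)
    qed simp
    show "centre_cost M p f (D \<union> C) (x i) \<le> centre_cost M p f (D \<union> C) z" for z
    proof (rule optimal_assignment_centre(2)[OF switch[of i]])
      show "D \<union> C = {w \<in> space M. (if w \<in> C then i else c w) = i}"
        by (auto simp: D_def C_def)
    qed (use int_D int_C in \<open>auto intro: set_integrable_Un\<close>)
  qed (use C_fin D_fin in \<open>auto simp: D_def\<close>)
  moreover have "centre_cost M p f C y < centre_cost M p f C (x i)"
  proof -
    have strict: "norm (f w - y) powr p < norm (f w - x i) powr p" if "w \<in> C" for w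
      using that far[of w] p by (intro powr_less_mono2) (auto simp: C_def)
    have "0 < (LINT w|M. indicator C w *\<^sub>R norm (f w - x i) powr p - indicator C w *\<^sub>R norm (f w - y) powr p)"
    proof (rule ccontr)
      let ?g = "\<lambda>w. indicator C w *\<^sub>R norm (f w - x i) powr p - indicator C w *\<^sub>R norm (f w - y) powr p"
      assume "\<not> 0 < integral\<^sup>L M ?g"
      moreover have nonneg: "0 \<le> ?g w" for w
        using strict[of w] by (auto split: split_indicator)
      moreover have "integrable M ?g"
        using int_C unfolding set_integrable_def by (intro Bochner_Integration.integrable_diff)
      ultimately have "AE w in M. ?g w = 0"
        using integral_nonneg_eq_0_iff_AE[where M=M and f="?g"] integral_nonneg_AE[where M=M and f="?g"]
        by (simp add: antisym)
      then have "AE w in M. w \<notin> C"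
      proof eventually_elim
        case (elim w)
        then show ?case using strict[of w] by (cases "w \<in> C") auto
      qed
      then show False using C_pos by simp
    qed
    then show ?thesis
      using int_C unfolding set_integrable_def centre_cost_def set_lebesgue_integral_def
      by (simp add: Bochner_Integration.integral_diff)
  qed
  ultimately show False by simp
qed

text \<open>
  Two different centres are not both 0, and the tie condition is symmetric in them.
\<close>

lemma no_ties:
  fixes f :: "'w \<Rightarrow> 'a::banach"
  assumes gateaux: "\<And>x::'a. x \<noteq> 0 \<Longrightarrow> gateaux_differentiable_at norm x"
    and p: "1 < p" and f: "f \<in> Lp_space M p"
    and opt: "optimal_assignment M p f m x c"
    and ij: "i < m" "j < m" "x i \<noteq> x j"
  shows "AE w in M. \<not> (norm (f w - x i) = norm (f w - x j) \<and> norm (f w - x i) = norm (f w - x (c w)))"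
proof (cases "x i = 0")
  case False
  then show ?thesis
    using no_ties_at_nonzero_centre[OF gateaux p f opt ij] by simp
next
  case True
  then have "AE w in M. \<not> (norm (f w - x j) = norm (f w - x i) \<and> norm (f w - x j) = norm (f w - x (c w)))"
    using no_ties_at_nonzero_centre[OF gateaux p f opt ij(2,1)] ij(3) by simp
  then show ?thesis
    by eventually_elim auto
qed

section \<open>Pieces of an optimal assignment have their centres as means\<close>

lemma Mp_eq_centre_cost:
  assumes "set_integrable M D (\<lambda>w. norm (f w - y) powr p)"
  shows "Mp M p f D y = ennreal (centre_cost M p f D y)"
proof -
  have "Mp M p f D y = (\<integral>\<^sup>+w. ennreal (indicator D w *\<^sub>R norm (f w - y) powr p) \<partial>M)"
    unfolding Mp_def by (intro nn_integral_cong) (auto split: split_indicator)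
  also have "\<dots> = ennreal (centre_cost M p f D y)"
    using assms unfolding centre_cost_def set_lebesgue_integral_def set_integrable_def
    by (intro nn_integral_eq_integral) auto
  finally show ?thesis .
qed

lemma set_integrable_if_Mp_finite:
  fixes f :: "'w \<Rightarrow> 'a::banach"
  assumes "strongly_measurable M f" "D \<in> sets M" "Mp M p f D y < \<infinity>"
  shows "set_integrable M D (\<lambda>w. norm (f w - y) powr p)"
  unfolding set_integrable_def
proof (rule integrableI_nonneg)
  note [measurable] = borel_measurable_norm_diff_const[OF assms(1)] assms(2)
  show "(\<lambda>w. indicator D w *\<^sub>R norm (f w - y) powr p) \<in> borel_measurable M"
    by measurable
  have "(\<integral>\<^sup>+w. ennreal (indicator D w *\<^sub>R norm (f w - y) powr p) \<partial>M) = Mp M p f D y"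
    unfolding Mp_def by (intro nn_integral_cong) (auto split: split_indicator)
  then show "(\<integral>\<^sup>+w. ennreal (indicator D w *\<^sub>R norm (f w - y) powr p) \<partial>M) < \<infinity>"
    using assms(3) by simp
qed auto

text \<open>
  Competitors \<open>y\<close> of infinite cost are harmless; for the others the comparison takes place among
  finite integrals.
\<close>

lemma optimal_assignment_pth_mean:
  fixes f :: "'w \<Rightarrow> 'a::banach"
  assumes f: "strongly_measurable M f" and opt: "optimal_assignment M p f m x c"
    and D: "D = {w \<in> space M. c w = i}"
  shows "is_pth_mean M p f D (x i)"
proof -
  have [measurable]: "c \<in> measurable M (count_space UNIV)"
    using opt unfolding optimal_assignment_def assignment_into_def
    by (auto intro: measurable_simple_function)
  have D_sets: "D \<in> sets M"
    unfolding D by measurable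
  have "Mp M p f D (x i) \<le> Mp M p f D y" for y
  proof (cases "Mp M p f D y < \<infinity>")
    case True
    then have "set_integrable M D (\<lambda>w. norm (f w - y) powr p)"
      using f D_sets by (intro set_integrable_if_Mp_finite)
    note int = this optimal_assignment_centre[OF opt D this]
    show ?thesis
      unfolding Mp_eq_centre_cost[OF int(1)] Mp_eq_centre_cost[OF int(2)]
      by (intro ennreal_leI int(3))
  next
    case False
    then have "Mp M p f D y = \<infinity>"
      using less_top[of "Mp M p f D y"] by auto
    then show ?thesis by simp
  qed
  then show ?thesis
    unfolding is_pth_mean_def
    using INF_greatest[of UNIV "Mp M p f D (x i)" "Mp M p f D"] INF_lower[of "x i" UNIV "Mp M p f D"]
    by (auto intro: antisym)
qed

section \<open>Step functions and reduced forms\<close>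

lemma step_sum_eq:
  assumes "i < m" "w \<in> A i" "\<And>j. j < m \<Longrightarrow> j \<noteq> i \<Longrightarrow> w \<notin> A j"
  shows "step_sum m x A w = x i"
proof -
  have "step_sum m x A w = (\<Sum>j<m. if j = i then x i else 0)"
    unfolding step_sum_def using assms by (intro sum.cong) auto
  then show ?thesis using assms(1) by simp
qed

lemma simple_function_step_sum:
  assumes "\<And>i. i < m \<Longrightarrow> A i \<in> sets M"
  shows "simple_function M (step_sum m x A)"
proof -
  have "simple_function M (\<lambda>w. indicat_real (A i) w *\<^sub>R x i)" if "i < m" for i
    using simple_function_compose1[OF simple_function_indicator[OF assms[OF that]], of "\<lambda>r. r *\<^sub>R x i"] .
  then have "simple_function M (\<lambda>w. \<Sum>i<m. indicat_real (A i) w *\<^sub>R x i)"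
    by (rule simple_function_sum) simp
  then show ?thesis
    by (simp add: step_sum_def[abs_def])
qed

text \<open>
  A representation by a partition indexed by numbers is traded for a bound on the number of values,
  the form in which competitors arise by composing an assignment with a choice of centres.
\<close>

lemma Gpk_iff_simple_function:
  "g \<in> Gpk M p k \<longleftrightarrow> g \<in> Lp_space M p \<and>
     (\<exists>s. simple_function M s \<and> card (s ` space M) \<le> k \<and> (AE w in M. g w = s w))"
proof (intro iffI conjI)
  assume g: "g \<in> Gpk M p k"
  then show "g \<in> Lp_space M p" by (simp add: Gpk_def)
  obtain l x A where lxA: "l \<le> k" "\<And>i. i < l \<Longrightarrow> A i \<in> sets M" "disjoint_family_on A {..<l}"
      "(\<Union>i<l. A i) = space M" "AE w in M. g w = step_sum l x A w"
    using g unfolding Gpk_def by blast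
  have "step_sum l x A ` space M \<subseteq> x ` {..<l}"
  proof
    fix v assume "v \<in> step_sum l x A ` space M"
    then obtain w i where w: "v = step_sum l x A w" "i < l" "w \<in> A i"
      using lxA(4) by blast
    have "w \<notin> A j" if "j < l" "j \<noteq> i" for j
      using disjoint_family_onD[OF lxA(3), of i j] that w by auto
    then have "v = x i"
      unfolding w(1) using w(2,3) by (intro step_sum_eq)
    then show "v \<in> x ` {..<l}" using w by blast
  qed
  then have "card (step_sum l x A ` space M) \<le> k"
    using surj_card_le[OF finite_lessThan] lxA(1) by (metis card_lessThan le_trans)
  then show "\<exists>s. simple_function M s \<and> card (s ` space M) \<le> k \<and> (AE w in M. g w = s w)"
    using simple_function_step_sum[of l A M x] lxA(2,5) by (intro exI[of _ "step_sum l x A"]) simp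
next
  assume "g \<in> Lp_space M p \<and>
     (\<exists>s. simple_function M s \<and> card (s ` space M) \<le> k \<and> (AE w in M. g w = s w))"
  then obtain s where g: "g \<in> Lp_space M p" and s: "simple_function M s" "card (s ` space M) \<le> k"
      "AE w in M. g w = s w" by blast
  define l where "l = card (s ` space M)"
  obtain x where x: "bij_betw x {0..<l} (s ` space M)"
    using ex_bij_betw_nat_finite[OF simple_functionD(1)[OF s(1)]] unfolding l_def by blast
  define A where "A i = s -` {x i} \<inter> space M" for i
  have disj: "i = j" if "w \<in> A i" "w \<in> A j" "i < l" "j < l" for w i j
    using that x unfolding A_def bij_betw_def inj_on_def by auto
  have cover: "\<exists>i<l. w \<in> A i" if w: "w \<in> space M" for w
  proof -
    have "s w \<in> x ` {0..<l}" using x w by (auto simp: bij_betw_def)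
    then show ?thesis using w by (auto simp: A_def)
  qed
  have step_s: "step_sum l x A w = s w" if "w \<in> space M" for w
  proof -
    obtain i where i: "i < l" "w \<in> A i" using cover \<open>w \<in> space M\<close> by blast
    then have "step_sum l x A w = x i"
      using disj by (intro step_sum_eq) auto
    then show ?thesis using i by (simp add: A_def)
  qed
  have "AE w in M. g w = step_sum l x A w"
    using s(3) AE_space by eventually_elim (simp add: step_s)
  moreover have "(\<Union>i<l. A i) = space M"
    using cover by (fastforce simp: A_def)
  moreover have "\<forall>i<l. A i \<in> sets M"
    using simple_functionD(2)[OF s(1)] by (simp add: A_def)
  moreover have "disjoint_family_on A {..<l}"
    using disj unfolding disjoint_family_on_def by blast
  ultimately show "g \<in> Gpk M p k"
    using g s(2) unfolding Gpk_def l_def[symmetric]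
    by (intro CollectI conjI exI[of _ l] exI[of _ x] exI[of _ A]) auto
qed

text \<open>
  The pieces are the fibres of the values that are taken with positive measure; the finitely many
  other fibres form a null set.
\<close>

lemma reduced_form_exists:
  assumes s: "simple_function M s" and hs: "AE w in M. h w = s w"
  shows "\<exists>m x A. reduced_form M h m x A"
proof -
  define V where "V = {v \<in> s ` space M. 0 < emeasure M (s -` {v} \<inter> space M)}"
  define m where "m = card V"
  have "finite V"
    using simple_functionD(1)[OF s] by (simp add: V_def)
  then obtain x where x: "bij_betw x {0..<m} V"
    unfolding m_def using ex_bij_betw_nat_finite by blast
  define A where "A i = s -` {x i} \<inter> space M" for i
  have fibre: "s -` {v} \<inter> space M \<in> sets M" for v
    using simple_functionD(2)[OF s] .
  have x_V: "x i \<in> V" if "i < m" for i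
    using x that unfolding bij_betw_def by auto
  have inj: "inj_on x {..<m}"
    using x unfolding bij_betw_def by (simp add: atLeast0LessThan)
  have disj: "i = j" if "w \<in> A i" "w \<in> A j" "i < m" "j < m" for w i j
    using that inj unfolding A_def inj_on_def by auto
  have "space M - (\<Union>i<m. A i) \<subseteq> (\<Union>v\<in>s ` space M - V. s -` {v} \<inter> space M)"
  proof
    fix w assume w: "w \<in> space M - (\<Union>i<m. A i)"
    then have "s w \<notin> x ` {0..<m}"
      by (force simp: A_def)
    then have "s w \<notin> V"
      using x by (simp add: bij_betw_def)
    then show "w \<in> (\<Union>v\<in>s ` space M - V. s -` {v} \<inter> space M)"
      using w by auto
  qed
  moreover have "(\<Union>v\<in>s ` space M - V. s -` {v} \<inter> space M) \<in> null_sets M"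
    using simple_functionD(1)[OF s] fibre
    by (intro null_sets.finite_UN) (auto simp: V_def null_sets_def not_gr_zero)
  moreover have A_sets: "A i \<in> sets M" for i
    using fibre by (simp add: A_def)
  ultimately have null: "space M - (\<Union>i<m. A i) \<in> null_sets M"
    by (auto intro: null_sets_subset)
  have "AE w in M. h w = step_sum m x A w"
    using hs AE_not_in[OF null] AE_space
  proof eventually_elim
    case (elim w)
    then obtain i where i: "i < m" "w \<in> A i" by auto
    then have "step_sum m x A w = x i"
      using disj by (intro step_sum_eq) auto
    then show ?case using i elim by (simp add: A_def)
  qed
  moreover have "A i \<inter> A j \<in> null_sets M" if "i < m" "j < m" "i \<noteq> j" for i j
    using disj that by (subgoal_tac "A i \<inter> A j = {}") auto
  moreover have "0 < emeasure M (A i)" if "i < m" for i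
    using x_V[OF that] by (simp add: V_def A_def)
  ultimately have "reduced_form M h m x A"
    using inj A_sets null unfolding reduced_form_def by auto
  then show ?thesis by blast
qed

section \<open>Minimizers as optimal assignments\<close>

lemma minimizer_le:
  assumes h: "is_minimizer M p k f h" and g: "g \<in> Gpk M p k" and p: "0 < p"
  shows "(LINT w|M. norm (f w - h w) powr p) \<le> (LINT w|M. norm (f w - g w) powr p)"
proof (rule ccontr)
  have "Lp_norm M p (\<lambda>w. f w - h w) \<le> Lp_norm M p (\<lambda>w. f w - g w)"
    using h g unfolding is_minimizer_def
    by (auto intro!: cINF_lower bdd_belowI2[of _ 0] simp: Lp_norm_def)
  moreover assume "\<not> ?thesis"
  then have "Lp_norm M p (\<lambda>w. f w - g w) < Lp_norm M p (\<lambda>w. f w - h w)"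
    unfolding Lp_norm_def using p by (intro powr_less_mono2) auto
  ultimately show False by simp
qed

lemma reduced_form_AE_unique_piece:
  assumes "reduced_form M h m x A"
  shows "AE w in M. \<exists>i<m. w \<in> A i \<and> (\<forall>j<m. j \<noteq> i \<longrightarrow> w \<notin> A j)"
proof -
  have "AE w in M. w \<notin> space M - (\<Union>i<m. A i)"
    using assms unfolding reduced_form_def by (intro AE_not_in) auto
  moreover have "AE w in M. \<forall>i\<in>{..<m}. \<forall>j\<in>{..<m}. i \<noteq> j \<longrightarrow> w \<notin> A i \<inter> A j"
  proof (intro AE_finite_allI)
    fix i j assume "i \<in> {..<m}" "j \<in> {..<m}"
    then have "A i \<inter> A j \<in> null_sets M" if "i \<noteq> j"
      using assms that unfolding reduced_form_def by auto
    then show "AE w in M. i \<noteq> j \<longrightarrow> w \<notin> A i \<inter> A j"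
      by (cases "i = j") (auto dest: AE_not_in)
  qed auto
  ultimately show ?thesis
    using AE_space
  proof eventually_elim
    case (elim w)
    then obtain i where "i < m" "w \<in> A i" by blast
    moreover have "w \<notin> A j" if "j < m" "j \<noteq> i" for j
      using elim(2) that calculation by blast
    ultimately show ?case by blast
  qed
qed

text \<open>
  Each \<open>x i\<close> is taken with positive measure, so every simple representative of \<open>h\<close> takes it somewhere.
\<close>

lemma reduced_form_size_le:
  assumes red: "reduced_form M h m x A" and h: "h \<in> Gpk M p k"
  shows "m \<le> k"
proof -
  obtain s where s: "simple_function M s" "card (s ` space M) \<le> k" "AE w in M. h w = s w"
    using h unfolding Gpk_iff_simple_function by blast
  have "x i \<in> s ` space M" if i: "i < m" for i
  proof (rule ccontr)
    assume no: "x i \<notin> s ` space M"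
    have "AE w in M. h w = step_sum m x A w"
      using red unfolding reduced_form_def by blast
    then have "AE w in M. w \<notin> A i"
      using s(3) reduced_form_AE_unique_piece[OF red] AE_space
    proof eventually_elim
      case (elim w)
      show ?case
      proof
        assume w: "w \<in> A i"
        then have "step_sum m x A w = x i"
          using elim(3) i by (intro step_sum_eq) blast+
        then have "x i = s w"
          using elim(1,2) by simp
        then show False using elim(4) no by blast
      qed
    qed
    moreover have "A i \<in> sets M" "0 < emeasure M (A i)"
      using red i unfolding reduced_form_def by auto
    ultimately have "A i \<in> null_sets M"
      by (subst AE_iff_null_sets)
    then show False
      using \<open>0 < emeasure M (A i)\<close> by (simp add: null_sets_def)
  qed
  then have "card (x ` {..<m}) \<le> card (s ` space M)"
    using simple_functionD(1)[OF s(1)] by (intro card_mono) auto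
  then show ?thesis
    using red s(2) by (simp add: reduced_form_def card_image)
qed

text \<open>
  The pieces of a reduced form overlap and miss points on null sets, so they do not define an
  assignment directly.  It is read off from the value of the step function instead, which determines
  the index because the values are different.
\<close>

lemma reduced_minimizer_optimal_assignment:
  fixes f h :: "'w \<Rightarrow> 'a::banach"
  assumes f: "f \<in> Lp_space M p" and p: "0 < p" and minim: "is_minimizer M p k f h"
    and red: "reduced_form M h m x A" and m: "0 < m"
  obtains c where "optimal_assignment M p f m x c" "AE w in M. \<forall>i<m. w \<in> A i \<longleftrightarrow> c w = i"
proof -
  have f_meas: "strongly_measurable M f" and f_int: "integrable M (\<lambda>w. norm (f w) powr p)"
    using f by (auto simp: Lp_space_def)
  have hG: "h \<in> Gpk M p k"
    using minim by (simp add: is_minimizer_def)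
  then have h_meas: "strongly_measurable M h" and h_int: "integrable M (\<lambda>w. norm (h w) powr p)"
    by (auto simp: Gpk_def Lp_space_def)
  have inj: "inj_on x {..<m}" and A_sets: "\<And>i. i < m \<Longrightarrow> A i \<in> sets M"
    and h_eq: "AE w in M. h w = step_sum m x A w"
    using red unfolding reduced_form_def by auto
  \<comment> \<open>The default 0 is a legitimate index as \<open>0 < m\<close>; it is used on a null set only.\<close>
  define label where "label v = (if v \<in> x ` {..<m} then the_inv_into {..<m} x v else 0)" for v
  define c where "c w = label (step_sum m x A w)" for w
  have "simple_function M c"
    unfolding c_def using simple_function_step_sum[OF A_sets] by (rule simple_function_compose1)
  moreover have "c w < m" for w
    using m the_inv_into_into[OF inj, of _ "{..<m}"] by (auto simp: c_def label_def)
  ultimately have c: "assignment_into m M c"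
    by (simp add: assignment_into_def)
  have c_eq: "c w = i" "step_sum m x A w = x i"
    if "i < m" "w \<in> A i" "\<And>j. j < m \<Longrightarrow> j \<noteq> i \<Longrightarrow> w \<notin> A j" for w i
  proof -
    show "step_sum m x A w = x i"
      using that by (rule step_sum_eq)
    then show "c w = i"
      using that(1) by (simp add: c_def label_def the_inv_into_f_f[OF inj])
  qed
  have pieces: "AE w in M. \<forall>i<m. w \<in> A i \<longleftrightarrow> c w = i"
    using reduced_form_AE_unique_piece[OF red]
  proof eventually_elim
    case (elim w)
    then obtain i where "i < m" "w \<in> A i" "\<forall>j<m. j \<noteq> i \<longrightarrow> w \<notin> A j" by blast
    then show ?case using c_eq(1)[of i w] by auto
  qed
  have hc: "AE w in M. h w = x (c w)"
    using h_eq reduced_form_AE_unique_piece[OF red]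
  proof eventually_elim
    case (elim w)
    then obtain i where "i < m" "w \<in> A i" "\<forall>j<m. j \<noteq> i \<longrightarrow> w \<notin> A j" by blast
    then show ?case using c_eq[of i w] elim(1) by auto
  qed
  note [measurable] = borel_measurable_norm_diff[OF f_meas h_meas]
    borel_measurable_norm_diff_assignment[OF f_meas c]
  have int: "integrable M (\<lambda>w. norm (f w - x (c w)) powr p)"
  proof (rule Bochner_Integration.integrable_bound)
    show "integrable M (\<lambda>w. 2 powr p * (norm (f w) powr p + norm (h w) powr p))"
      using f_int h_int by (intro integrable_mult_right Bochner_Integration.integrable_add)
    show "AE w in M. norm (norm (f w - x (c w)) powr p)
        \<le> norm (2 powr p * (norm (f w) powr p + norm (h w) powr p))"
      using hc
    proof eventually_elim
      case (elim w)
      then show ?case using norm_diff_powr_le[of p "f w" "h w"] p by simp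
    qed
  qed measurable
  have cost_eq: "(LINT w|M. norm (f w - x (c w)) powr p) = (LINT w|M. norm (f w - h w) powr p)"
    using hc by (intro integral_cong_AE) (measurable, auto)
  have "(LINT w|M. norm (f w - x (c w)) powr p) \<le> (LINT w|M. norm (f w - y (d w)) powr p)"
    if d: "assignment_into m M d" and int_d: "integrable M (\<lambda>w. norm (f w - y (d w)) powr p)" for y d
  proof -
    have simple: "simple_function M (\<lambda>w. y (d w))"
      using d unfolding assignment_into_def by (blast intro: simple_function_compose1[of M d y])
    have "integrable M (\<lambda>w. norm (y (d w)) powr p)"
    proof (rule Bochner_Integration.integrable_bound)
      show "integrable M (\<lambda>w. 2 powr p * (norm (f w) powr p + norm (f w - y (d w)) powr p))"
        using f_int int_d by (intro integrable_mult_right Bochner_Integration.integrable_add)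
      have "simple_function M (\<lambda>w. norm (y (d w)) powr p)"
        using simple by (rule simple_function_compose1)
      then show "(\<lambda>w. norm (y (d w)) powr p) \<in> borel_measurable M"
        by (rule borel_measurable_simple_function)
      have "norm (y (d w)) powr p \<le> 2 powr p * (norm (f w) powr p + norm (f w - y (d w)) powr p)" for w
        using norm_diff_powr_le[of p "f w" "f w - y (d w)"] p by simp
      then show "AE w in M. norm (norm (y (d w)) powr p)
          \<le> norm (2 powr p * (norm (f w) powr p + norm (f w - y (d w)) powr p))"
        by auto
    qed
    then have "(\<lambda>w. y (d w)) \<in> Lp_space M p"
      using simple by (simp add: Lp_space_def strongly_measurable_simple_function)
    moreover have "card ((\<lambda>w. y (d w)) ` space M) \<le> k"
    proof -
      have "(\<lambda>w. y (d w)) ` space M \<subseteq> y ` {..<m}"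
        using d by (auto simp: assignment_into_def)
      then have "card ((\<lambda>w. y (d w)) ` space M) \<le> m"
        using surj_card_le[OF finite_lessThan] by (metis card_lessThan)
      then show ?thesis
        using reduced_form_size_le[OF red hG] by simp
    qed
    ultimately have "(\<lambda>w. y (d w)) \<in> Gpk M p k"
      unfolding Gpk_iff_simple_function using simple by blast
    then show ?thesis
      unfolding cost_eq by (rule minimizer_le[OF minim _ p])
  qed
  then have "optimal_assignment M p f m x c"
    using c int unfolding optimal_assignment_def by blast
  then show thesis
    using pieces by (rule that)
qed

lemma reduced_minimizer_simple_special_voronoi:
  fixes f h :: "'w \<Rightarrow> 'a::banach"
  assumes gateaux: "\<And>x::'a. x \<noteq> 0 \<Longrightarrow> gateaux_differentiable_at norm x"
    and p: "1 < p" and f: "f \<in> Lp_space M p" and minim: "is_minimizer M p k f h"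
    and red: "reduced_form M h m x A" and m: "0 < m"
  shows "simple_special_voronoi_form M p f h m x A"
proof -
  have f_meas: "strongly_measurable M f"
    using f by (simp add: Lp_space_def)
  note [measurable] = borel_measurable_norm_diff_const[OF f_meas]
  obtain c where opt: "optimal_assignment M p f m x c"
    and pieces: "AE w in M. \<forall>i<m. w \<in> A i \<longleftrightarrow> c w = i"
    using reduced_minimizer_optimal_assignment[OF f _ minim red m] p by auto
  have c_less: "c w < m" if "w \<in> space M" for w
    using opt that unfolding optimal_assignment_def assignment_into_def by blast
  have inj: "inj_on x {..<m}" and A_sets [measurable]: "\<And>i. i < m \<Longrightarrow> A i \<in> sets M"
    using red unfolding reduced_form_def by auto
  have nearest: "AE w in M. \<forall>j<m. norm (f w - x (c w)) \<le> norm (f w - x j)"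
    using optimal_assignment_nearest[OF f_meas _ opt] p by simp
  have cells: "A i - f -` voronoi_cell m x i \<in> null_sets M" if i: "i < m" for i
  proof -
    have "A i - f -` voronoi_cell m x i
        = A i - {w \<in> space M. \<forall>j<m. j \<noteq> i \<longrightarrow> norm (f w - x i) \<le> norm (f w - x j)}"
      using sets.sets_into_space[OF A_sets[OF i]] by (auto simp: voronoi_cell_def)
    moreover have "\<dots> \<in> sets M"
      using A_sets[OF i] by measurable
    ultimately have "A i - f -` voronoi_cell m x i \<in> sets M" by simp
    moreover have "AE w in M. w \<notin> A i - f -` voronoi_cell m x i"
      using nearest pieces by eventually_elim (use i in \<open>auto simp: voronoi_cell_def\<close>)
    ultimately show ?thesis
      by (simp add: AE_iff_null_sets)
  qed
  have means: "is_pth_mean M p f (A i) (x i)" if i: "i < m" for i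
  proof -
    have "Mp M p f (A i) y = Mp M p f {w \<in> space M. c w = i} y" for y
      unfolding Mp_def
    proof (rule nn_integral_cong_AE)
      show "AE w in M. ennreal (norm (f w - y) powr p) * indicator (A i) w
          = ennreal (norm (f w - y) powr p) * indicator {w \<in> space M. c w = i} w"
        using pieces AE_space by eventually_elim (use i in \<open>auto split: split_indicator\<close>)
    qed
    then show ?thesis
      using optimal_assignment_pth_mean[OF f_meas opt refl, of i] by (simp add: is_pth_mean_def)
  qed
  have boundaries: "f -` voronoi_boundary m x i \<inter> space M \<in> null_sets M" if i: "i < m" for i
  proof -
    have "f -` voronoi_boundary m x i \<inter> space M
        = {w \<in> space M. (\<forall>j<m. j \<noteq> i \<longrightarrow> norm (f w - x i) \<le> norm (f w - x j)) \<and>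
            \<not> (\<forall>j<m. j \<noteq> i \<longrightarrow> norm (f w - x i) < norm (f w - x j))}"
      by (auto simp: voronoi_boundary_def voronoi_cell_def voronoi_int_def)
    moreover have "\<dots> \<in> sets M"
      by measurable
    ultimately have sets: "f -` voronoi_boundary m x i \<inter> space M \<in> sets M" by simp
    have "AE w in M. \<forall>j\<in>{..<m} - {i}.
        \<not> (norm (f w - x i) = norm (f w - x j) \<and> norm (f w - x i) = norm (f w - x (c w)))"
      using i inj by (intro AE_finite_allI no_ties[OF gateaux p f opt]) (auto dest: inj_onD)
    then have "AE w in M. w \<notin> f -` voronoi_boundary m x i \<inter> space M"
      using nearest AE_space
    proof eventually_elim
      case (elim w)
      show ?case
      proof
        assume "w \<in> f -` voronoi_boundary m x i \<inter> space M"
        then obtain j where j: "j < m" "j \<noteq> i" "norm (f w - x j) \<le> norm (f w - x i)"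
          and cell: "\<And>j. j < m \<Longrightarrow> j \<noteq> i \<Longrightarrow> norm (f w - x i) \<le> norm (f w - x j)"
          unfolding voronoi_boundary_def voronoi_cell_def voronoi_int_def by force
        have "norm (f w - x i) = norm (f w - x j)"
          using j cell[of j] by simp
        moreover have "norm (f w - x i) = norm (f w - x (c w))"
          using elim(2) i cell[of "c w"] c_less[OF elim(3)] by (cases "c w = i") (auto intro: antisym)
        ultimately show False
          using bspec[OF elim(1), of j] j by simp
      qed
    qed
    then show ?thesis
      using sets by (simp add: AE_iff_null_sets)
  qed
  show ?thesis
    unfolding simple_special_voronoi_form_def special_voronoi_form_def voronoi_form_def
    using red cells means boundaries by blast
qed

theorem proposition4p4:
  fixes M :: "'w measure" and f h :: "'w \<Rightarrow> 'a::banach" and p :: real and k :: nat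
  assumes gateaux: "\<And>x::'a. x \<noteq> 0 \<Longrightarrow> gateaux_differentiable_at norm x"
    and "1 < p" and "1 \<le> k"
    and "f \<in> Lp_space M p"
    and "is_minimizer M p k f h"
  shows "(\<exists>m x A. reduced_form M h m x A) \<and>
    (\<forall>m x A. reduced_form M h m x A \<longrightarrow> simple_special_voronoi_form M p f h m x A)"
proof (intro conjI allI impI)
  have "h \<in> Gpk M p k"
    using assms(5) by (simp add: is_minimizer_def)
  then show "\<exists>m x A. reduced_form M h m x A"
    unfolding Gpk_iff_simple_function by (blast intro: reduced_form_exists)
next
  fix m x A assume red: "reduced_form M h m x A"
  show "simple_special_voronoi_form M p f h m x A"
  proof (cases "m = 0")
    case True
    with red show ?thesis
      by (simp add: simple_special_voronoi_form_def special_voronoi_form_def voronoi_form_def)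
  next
    case False
    then show ?thesis
      using reduced_minimizer_simple_special_voronoi[OF gateaux assms(2,4,5) red] by simp
  qed
qed

end
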